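(* Let $G$ be a finite group, and let $x$ and $y$ be elements of $G$. Then $x\equiv_{\mathrm m}y$ if and only if for all $r$ and all $z_1,\ldots,z_r\in G$, $$\langle x,z_1,\ldots,z_r\rangle=G\iff\langle y,z_1,\ldots,z_r\rangle=G.$$
   Context: For elements $x,y$ of a finite group $G$, $x\equiv_{\mathrm m}y$ means that $x$ and $y$ lie in exactly the same maximal subgroups of $G$. Here $r$ ranges over the non-negative integers. *)

theory Defs
  imports "HOL-Algebra.Generated_Groups"
begin

definition maximal_subgroup :: "'a set \<Rightarrow> ('a, 'b) monoid_scheme \<Rightarrow> bool" where
  "maximal_subgroup M G \<longleftrightarrow>
     subgroup M G \<and> M \<noteq> carrier G \<and>
     (\<forall>K. subgroup K G \<and> M \<subseteq> K \<longrightarrow> K = M \<or> K = carrier G)"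

definition equiv_m :: "('a, 'b) monoid_scheme \<Rightarrow> 'a \<Rightarrow> 'a \<Rightarrow> bool" where
  "equiv_m G x y \<longleftrightarrow> (\<forall>M. maximal_subgroup M G \<longrightarrow> (x \<in> M \<longleftrightarrow> y \<in> M))"

end

theory Submission
  imports Defs
begin

text \<open>
  In a finite group every proper subgroup lies in a maximal one, so a subset generates the group
  if and only if no maximal subgroup contains it. This criterion gives the forward direction.
  Conversely, if a maximal subgroup \<open>M\<close> contained \<open>x\<close> but not \<open>y\<close>, then taking the \<open>z\<^sub>i\<close> to be
  all elements of \<open>M\<close> would separate \<open>x\<close> from \<open>y\<close>.
\<close>

text \<open>A finite carrier has only finitely many subsets, so among the proper subgroups there is
  an inclusion-maximal one above \<open>H\<close>.\<close>

lemma proper_subgroup_in_maximal: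
  assumes "finite (carrier G)" "subgroup H G" "H \<noteq> carrier G"
  obtains M where "maximal_subgroup M G" "H \<subseteq> M"
proof -
  let ?A = "{K. subgroup K G \<and> K \<noteq> carrier G}"
  have "?A \<subseteq> Pow (carrier G)"
    by (auto dest: subgroup.subset)
  then have "finite ?A"
    by (rule finite_subset) (simp add: assms(1))
  moreover have "H \<in> ?A"
    using assms by simp
  ultimately obtain M where M: "M \<in> ?A" "H \<subseteq> M" "\<forall>K\<in>?A. M \<subseteq> K \<longrightarrow> M = K"
    by (rule finite_has_maximal2[elim_format]) blast
  \<comment> \<open>A subgroup above \<open>M\<close> is either the whole carrier or again a member
    of \<open>?A\<close>, and then it equals \<open>M\<close>.\<close>
  then have "maximal_subgroup M G"
    by (auto simp: maximal_subgroup_def)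
  then show thesis
    using M(2) by (rule that)
qed

text \<open>A subgroup contains \<open>S\<close> exactly when it contains
  \<open>generate G S\<close>, so the question is whether the generated subgroup is proper, that is,
  whether it lies in a maximal one.\<close>

lemma (in group) generate_eq_carrier_iff:
  assumes "finite (carrier G)" "S \<subseteq> carrier G"
  shows "generate G S = carrier G \<longleftrightarrow> (\<forall>M. maximal_subgroup M G \<longrightarrow> \<not> S \<subseteq> M)"
proof
  assume gen: "generate G S = carrier G"
  show "\<forall>M. maximal_subgroup M G \<longrightarrow> \<not> S \<subseteq> M"
  proof (intro allI impI notI)
    fix M assume M: "maximal_subgroup M G" and "S \<subseteq> M"
    then have "subgroup M G" "M \<noteq> carrier G"
      by (auto simp: maximal_subgroup_def)
    moreover have "carrier G \<subseteq> M"
      using generate_subgroup_incl[OF \<open>S \<subseteq> M\<close> \<open>subgroup M G\<close>] gen by simp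
    ultimately show False
      using subgroup.subset[of M G] by blast
  qed
next
  assume none: "\<forall>M. maximal_subgroup M G \<longrightarrow> \<not> S \<subseteq> M"
  show "generate G S = carrier G"
  proof (rule ccontr)
    assume "generate G S \<noteq> carrier G"
    then obtain M where "maximal_subgroup M G" "generate G S \<subseteq> M"
      using proper_subgroup_in_maximal[OF assms(1) generate_is_subgroup[OF assms(2)]] by blast
    moreover have "S \<subseteq> generate G S"
      by (intro subsetI generate.incl)
    ultimately show False
      using none by blast
  qed
qed

text \<open>If \<open>a\<close> lies in \<open>M\<close>, nothing outside \<open>M\<close> is
  generated; otherwise the generated subgroup is strictly larger than \<open>M\<close>, and
  maximality leaves only \<open>carrier G\<close>. Generation thus detects membership in
  \<open>M\<close>.\<close>

lemma (in group) generate_insert_maximal_subgroup: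
  assumes "maximal_subgroup M G" "a \<in> carrier G"
  shows "generate G (insert a M) = carrier G \<longleftrightarrow> a \<notin> M"
proof -
  have M: "subgroup M G" "M \<noteq> carrier G"
    using assms(1) by (auto simp: maximal_subgroup_def)
  have sub: "subgroup (generate G (insert a M)) G"
    by (rule generate_is_subgroup) (use subgroup.subset[OF M(1)] assms(2) in simp)
  have incl: "insert a M \<subseteq> generate G (insert a M)"
    by (intro subsetI generate.incl)
  show ?thesis
  proof (cases "a \<in> M")
    case True
    then have "generate G (insert a M) \<subseteq> M"
      by (intro generate_subgroup_incl[OF _ M(1)]) simp
    then have "generate G (insert a M) \<noteq> carrier G"
      using M subgroup.subset[OF M(1)] by blast
    then show ?thesis
      using True by simp
  next
    case False
    then have "generate G (insert a M) \<noteq> M"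
      using incl by blast
    then show ?thesis
      using False sub incl assms(1) by (auto simp: maximal_subgroup_def)
  qed
qed

theorem proposition2p2:
  fixes G :: "('a, 'b) monoid_scheme" and x y :: 'a
  assumes "group G"
    and "finite (carrier G)"
    and "x \<in> carrier G"
    and "y \<in> carrier G"
  shows "equiv_m G x y \<longleftrightarrow>
    (\<forall>(r :: nat) (z :: nat \<Rightarrow> 'a).
       (\<forall>i\<in>{1..r}. z i \<in> carrier G) \<longrightarrow>
         (generate G ({x} \<union> z ` {1..r}) = carrier G \<longleftrightarrow>
          generate G ({y} \<union> z ` {1..r}) = carrier G))"
proof -
  interpret group G by fact
  show ?thesis
  proof (rule iffI, intro allI impI)
    fix r :: nat and z :: "nat \<Rightarrow> 'a"
    assume "equiv_m G x y" and "\<forall>i\<in>{1..r}. z i \<in> carrier G"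
    then have "{x} \<union> z ` {1..r} \<subseteq> carrier G" "{y} \<union> z ` {1..r} \<subseteq> carrier G"
      using assms(3,4) by auto
    then show "generate G ({x} \<union> z ` {1..r}) = carrier G \<longleftrightarrow>
        generate G ({y} \<union> z ` {1..r}) = carrier G"
      using \<open>equiv_m G x y\<close> by (simp add: generate_eq_carrier_iff[OF assms(2)] equiv_m_def)
  next
    assume gen: "\<forall>(r :: nat) (z :: nat \<Rightarrow> 'a). (\<forall>i\<in>{1..r}. z i \<in> carrier G) \<longrightarrow>
        (generate G ({x} \<union> z ` {1..r}) = carrier G \<longleftrightarrow>
         generate G ({y} \<union> z ` {1..r}) = carrier G)"
    show "equiv_m G x y"
      unfolding equiv_m_def
    proof (intro allI impI)
      fix M assume M: "maximal_subgroup M G"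
      then have sub: "M \<subseteq> carrier G"
        using subgroup.subset by (auto simp: maximal_subgroup_def)
      then have "finite M"
        using assms(2) finite_subset by blast
      \<comment> \<open>Listing \<open>M\<close> as a family on \<open>{1..card M}\<close> puts it
        in the form that \<open>gen\<close> accepts, with \<open>r = card M\<close>.\<close>
      then obtain z where z: "bij_betw z {1..card M} M"
        using ex_bij_betw_nat_finite_1 by blast
      then have "z ` {1..card M} = M"
        by (rule bij_betw_imp_surj_on)
      moreover from this have "\<forall>i\<in>{1..card M}. z i \<in> carrier G"
        using sub by blast
      ultimately have "generate G (insert x M) = carrier G \<longleftrightarrow>
          generate G (insert y M) = carrier G"
        using gen[rule_format, of "card M" z] by simp
      then show "x \<in> M \<longleftrightarrow> y \<in> M"
        using generate_insert_maximal_subgroup[OF M] assms(3,4) by blast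
    qed
  qed
qed

end
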